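(* Every provable U-Turn judgment is valid: for every IL proof tree $d$ with conclusion $[P]\,\mathsf{r}\,[Q]$ and all assertions $P',Q'$, if the judgment $d \vdash \langle P'\rangle\,\mathsf{r}\,\langle Q'\rangle$ is derivable with the U-Turn rules, then (1) the SIL triple $\langle P'\rangle\,\mathsf{r}\,\langle Q'\rangle$ is valid, (2) $P'\subseteq P$, (3) $Q'\subseteq Q$, and (4) either $P'=Q'=\varnothing$ or both $P'\neq\varnothing$ and $Q'\neq\varnothing$.
   Context: Language: arithmetic expressions $a$ and Boolean expressions $b$ are standard; atomic commands $\mathsf{c} ::= \mathtt{skip}\mid x:=a\mid b?\mid x:=\mathtt{nondet()}$; regular commands $\mathsf{r}::=\mathsf{c}\mid\mathsf{r};\mathsf{r}\mid\mathsf{r}\boxplus\mathsf{r}\mid\mathsf{r}^*$. States are pairs of a flag in $\{ok,er\}$ and a store $\sigma:\mathrm{Var}\to\mathbb{Z}$ ($\mathrm{Var}$ finite). Forward semantics on ok-states: $[\![\mathtt{skip}]\!]\sigma=\{\sigma\}$, $[\![x:=a]\!]\sigma=\{\sigma[x\mapsto[\![a]\!]\sigma]\}$, $[\![b?]\!]\sigma=\{\sigma\}$ if $b$ holds in $\sigma$ else $\varnothing$, $[\![x:=\mathtt{nondet()}]\!]\sigma=\{\sigma[x\mapsto v]\mid v\in\mathbb{Z}\}$ (results ok-tagged); every command maps an er-state $\sigma$ to $\{\sigma\}$; $[\![\mathsf{r}_1;\mathsf{r}_2]\!]\sigma=[\![\mathsf{r}_2]\!]([\![\mathsf{r}_1]\!]\sigma)$,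 $[\![\mathsf{r}_1\boxplus\mathsf{r}_2]\!]\sigma=[\![\mathsf{r}_1]\!]\sigma\cup[\![\mathsf{r}_2]\!]\sigma$, $[\![\mathsf{r}^*]\!]\sigma=\bigcup_{n\ge0}[\![\mathsf{r}]\!]^n\sigma$; all lifted to sets by union. Backward semantics $\overleftarrow{[\![\mathsf{r}]\!]}\sigma'=\{\sigma\mid\sigma'\in[\![\mathsf{r}]\!]\sigma\}$, lifted by union. Assertions are sets of states; $\land,\lor,\implies,\text{false}$ are intersection, union, inclusion, $\varnothing$. For a set of stores $P$: $ok{:}P$ (resp. $er{:}P$) is the set of ok- (resp. er-)tagged states whose store is in $P$; $P[a/x]=\{\sigma\mid\sigma[x\mapsto[\![a]\!]\sigma]\in P\}$; $\exists x.P=\{\sigma[x\mapsto v]\mid\sigma\in P, v\in\mathbb{Z}\}$; $\mathrm{sp}_{x:=a}(P)=\{\sigma[x\mapsto[\![a]\!]\sigma]\mid\sigma\in P\}$. SIL triple $\langle P\rangle\mathsf{r}\langle Q\rangle$ is valid iff $P\subseteq\overleftarrow{[\![\mathsf{r}]\!]}Q$; IL triple $[P]\mathsf{r}[Q]$ valid iff $Q\subseteq[\![\mathsf{r}]\!]P$. IL proof trees are built from the rules: (assign) $[ok{:}P]\,x:=a\,[ok{:}\mathrm{sp}_{x:=a}(P)]$; (assume) $[ok{:}P]\,b?\,[ok{:}P\land b]$; (nondet) $[ok{:}P]\,x:=\mathtt{nondet()}\,[ok{:}\exists x.P]$; (skip) $[ok{:}P]\,\mathtt{skip}\,[ok{:}P]$;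 (er-id) $[er{:}P]\,\mathsf{r}\,[er{:}P]$; (disj) from $[P_1]\mathsf{r}[Q_1]$ and $[P_2]\mathsf{r}[Q_2]$ infer $[P_1\lor P_2]\mathsf{r}[Q_1\lor Q_2]$; (cons) from $[P']\mathsf{r}[Q']$ with $P'\implies P$ and $Q\implies Q'$ infer $[P]\mathsf{r}[Q]$; (seq) from $[P]\mathsf{r}_1[R]$ and $[R]\mathsf{r}_2[Q]$ infer $[P]\mathsf{r}_1;\mathsf{r}_2[Q]$; (choiceL/R) from $[P]\mathsf{r}_i[Q]$ infer $[P]\mathsf{r}_1\boxplus\mathsf{r}_2[Q]$ ($i=1$ resp. $2$); (iter0) $[P]\mathsf{r}^*[P]$; (unroll) from $[P]\mathsf{r}^*;\mathsf{r}[Q]$ infer $[P]\mathsf{r}^*[Q]$. A U-Turn judgment $d\vdash\langle P'\rangle\mathsf{r}\langle Q'\rangle$ pairs an IL proof tree $d$ concluding $[P]\mathsf{r}[Q]$ with a SIL triple for the same $\mathsf{r}$. Its rules: (assign) if $d$ is the axiom $[ok{:}P]x:=a[ok{:}\mathrm{sp}_{x:=a}(P)]$ and $Q'\implies\mathrm{sp}_{x:=a}(P)$, then $d\vdash\langle ok{:}P\land Q'[a/x]\rangle x:=a\langle ok{:}Q'\rangle$; (nondet) if $d$ is the axiom $[ok{:}P]x:=\mathtt{nondet()}[ok{:}\exists x.P]$ and $Q'\implies\exists x.P$, then $d\vdash\langle ok{:}P\land\exists x.Q'\rangle x:=\mathtt{nondet()}\langle ok{:}Q'\rangle$; (assume)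 if $d$ is the axiom $[ok{:}P]b?[ok{:}P\land b]$ and $Q'\implies P\land b$, then $d\vdash\langle ok{:}Q'\rangle b?\langle ok{:}Q'\rangle$; (skip) if $d$ is the skip axiom with pre and post $P$ and $Q'\implies P$, then $d\vdash\langle Q'\rangle\mathtt{skip}\langle Q'\rangle$; (er-id) if $d$ is the axiom $[er{:}P]\mathsf{r}[er{:}P]$ and $Q'\implies P$, then $d\vdash\langle er{:}Q'\rangle\mathsf{r}\langle er{:}Q'\rangle$; (empty) for any $d$ concluding a triple for $\mathsf{r}$, $d\vdash\langle\text{false}\rangle\mathsf{r}\langle\text{false}\rangle$; (disj) if $d$ ends with IL (disj) with subtrees $d_1,d_2$, and $d_i\vdash\langle P_i'\rangle\mathsf{r}\langle Q_i'\rangle$ for $i=1,2$, then $d\vdash\langle P_1'\lor P_2'\rangle\mathsf{r}\langle Q_1'\lor Q_2'\rangle$; (seq) if $d$ ends with IL (seq) with subtrees $d_1$ (for $\mathsf{r}_1$) and $d_2$ (for $\mathsf{r}_2$), and $d_1\vdash\langle P'\rangle\mathsf{r}_1\langle R'\rangle$, $d_2\vdash\langle R'\rangle\mathsf{r}_2\langle Q'\rangle$, then $d\vdash\langle P'\rangle\mathsf{r}_1;\mathsf{r}_2\langle Q'\rangle$; (choiceL/R) if $d$ ends with IL (choiceL) (resp. choiceR) with subtree $d'$ and $d'\vdash\langle P'\rangle\mathsf{r}_1\langle Q'\rangle$ (resp. $\mathsf{r}_2$), then $d\vdash\langle P'\rangle\mathsf{r}_1\boxplus\mathsf{r}_2\langle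 Q'\rangle$; (iter0) if $d$ is the axiom $[P]\mathsf{r}^*[P]$ and $Q'\implies P$, then $d\vdash\langle Q'\rangle\mathsf{r}^*\langle Q'\rangle$; (unroll) if $d$ ends with IL (unroll) with subtree $d'$ and $d'\vdash\langle P'\rangle\mathsf{r}^*;\mathsf{r}\langle Q'\rangle$, then $d\vdash\langle P'\rangle\mathsf{r}^*\langle Q'\rangle$; (consIL) if $d$ ends with IL (cons) concluding $[P]\mathsf{r}[Q]$ from subtree $d'$, and $d'\vdash\langle P''\rangle\mathsf{r}\langle Q''\rangle$ with $Q''\implies Q$, then $d\vdash\langle P''\rangle\mathsf{r}\langle Q''\rangle$; (consSIL) if $d$ concludes $[P]\mathsf{r}[Q]$, $d\vdash\langle P''\rangle\mathsf{r}\langle Q''\rangle$, $\text{false}\not\equiv P'\implies P''$ and $Q''\implies Q'\implies Q$, then $d\vdash\langle P'\rangle\mathsf{r}\langle Q'\rangle$. *)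

theory Defs
  imports Main
begin

type_synonym 'v store = "'v \<Rightarrow> int"

datatype 'v aexp =
    Const int | Var 'v
  | Plus "'v aexp" "'v aexp" | Minus "'v aexp" "'v aexp" | Times "'v aexp" "'v aexp"

datatype 'v bexp =
    BConst bool | Not "'v bexp" | And "'v bexp" "'v bexp" | Or "'v bexp" "'v bexp"
  | Eq "'v aexp" "'v aexp" | Le "'v aexp" "'v aexp" | Less "'v aexp" "'v aexp"

primrec aval :: "'v aexp \<Rightarrow> 'v store \<Rightarrow> int" where
  "aval (Const n) \<sigma> = n"
| "aval (Var x) \<sigma> = \<sigma> x"
| "aval (Plus a1 a2) \<sigma> = aval a1 \<sigma> + aval a2 \<sigma>"
| "aval (Minus a1 a2) \<sigma> = aval a1 \<sigma> - aval a2 \<sigma>"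
| "aval (Times a1 a2) \<sigma> = aval a1 \<sigma> * aval a2 \<sigma>"

primrec bval :: "'v bexp \<Rightarrow> 'v store \<Rightarrow> bool" where
  "bval (BConst t) \<sigma> \<longleftrightarrow> t"
| "bval (Not b) \<sigma> \<longleftrightarrow> \<not> bval b \<sigma>"
| "bval (And b1 b2) \<sigma> \<longleftrightarrow> bval b1 \<sigma> \<and> bval b2 \<sigma>"
| "bval (Or b1 b2) \<sigma> \<longleftrightarrow> bval b1 \<sigma> \<or> bval b2 \<sigma>"
| "bval (Eq a1 a2) \<sigma> \<longleftrightarrow> aval a1 \<sigma> = aval a2 \<sigma>"
| "bval (Le a1 a2) \<sigma> \<longleftrightarrow> aval a1 \<sigma> \<le> aval a2 \<sigma>"
| "bval (Less a1 a2) \<sigma> \<longleftrightarrow> aval a1 \<sigma> < aval a2 \<sigma>"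

datatype 'v atom = Skip | Assign 'v "'v aexp" | Assume "'v bexp" | Nondet 'v

datatype 'v rcmd =
    Atom "'v atom"
  | Seq "'v rcmd" "'v rcmd"
  | Choice "'v rcmd" "'v rcmd"
  | Star "'v rcmd"

datatype flag = Ok | Er

type_synonym 'v state = "flag \<times> 'v store"
type_synonym 'v assn = "'v state set"


primrec atom_sem :: "'v atom \<Rightarrow> 'v store \<Rightarrow> 'v store set" where
  "atom_sem Skip \<sigma> = {\<sigma>}"
| "atom_sem (Assign x a) \<sigma> = {\<sigma>(x := aval a \<sigma>)}"
| "atom_sem (Assume b) \<sigma> = (if bval b \<sigma> then {\<sigma>} else {})"
| "atom_sem (Nondet x) \<sigma> = {\<sigma>(x := v) | v. True}"

text \<open>Extends a behaviour given on ok-states only: error states are propagated unchanged.\<close>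

definition er_strict :: "('v store \<Rightarrow> 'v state set) \<Rightarrow> 'v state \<Rightarrow> 'v state set" where
  "er_strict f st = (case st of (Ok, \<sigma>) \<Rightarrow> f \<sigma> | (Er, \<sigma>) \<Rightarrow> {(Er, \<sigma>)})"

definition lift :: "('v state \<Rightarrow> 'v state set) \<Rightarrow> 'v assn \<Rightarrow> 'v assn" where
  "lift f S = (\<Union>st\<in>S. f st)"

primrec sem :: "'v rcmd \<Rightarrow> 'v state \<Rightarrow> 'v state set" where
  "sem (Atom c) = er_strict (\<lambda>\<sigma>. Pair Ok ` atom_sem c \<sigma>)"
| "sem (Seq r1 r2) = er_strict (\<lambda>\<sigma>. lift (sem r2) (sem r1 (Ok, \<sigma>)))"
| "sem (Choice r1 r2) = er_strict (\<lambda>\<sigma>. sem r1 (Ok, \<sigma>) \<union> sem r2 (Ok, \<sigma>))"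
| "sem (Star r) = er_strict (\<lambda>\<sigma>. \<Union>n::nat. (lift (sem r) ^^ n) {(Ok, \<sigma>)})"

definition back_sem :: "'v rcmd \<Rightarrow> 'v state \<Rightarrow> 'v state set" where
  "back_sem r st' = {st. st' \<in> sem r st}"

definition valid_SIL :: "'v assn \<Rightarrow> 'v rcmd \<Rightarrow> 'v assn \<Rightarrow> bool" where
  "valid_SIL P r Q \<longleftrightarrow> P \<subseteq> lift (back_sem r) Q"


definition ok :: "'v store set \<Rightarrow> 'v assn" where
  "ok P = {(Ok, \<sigma>) | \<sigma>. \<sigma> \<in> P}"

definition er :: "'v store set \<Rightarrow> 'v assn" where
  "er P = {(Er, \<sigma>) | \<sigma>. \<sigma> \<in> P}"

definition holds :: "'v bexp \<Rightarrow> 'v store set" where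
  "holds b = {\<sigma>. bval b \<sigma>}"

definition subst :: "'v store set \<Rightarrow> 'v aexp \<Rightarrow> 'v \<Rightarrow> 'v store set" where
  "subst P a x = {\<sigma>. \<sigma>(x := aval a \<sigma>) \<in> P}"

definition ex_var :: "'v \<Rightarrow> 'v store set \<Rightarrow> 'v store set" where
  "ex_var x P = {\<sigma>(x := v) | \<sigma> v. \<sigma> \<in> P}"

definition sp_assign :: "'v \<Rightarrow> 'v aexp \<Rightarrow> 'v store set \<Rightarrow> 'v store set" where
  "sp_assign x a P = {\<sigma>(x := aval a \<sigma>) | \<sigma>. \<sigma> \<in> P}"


text \<open>
  Incorrectness logic proof trees are first-class objects, because the U-Turn rules inspect them.
  A node names the rule applied and stores only those data of the rule instance that its subtrees
  do not determine: \<open>T_cons P Q d\<close> records the new pre- and postcondition, and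
  the choice nodes record the branch not taken. The relation \<open>il_proof d P r Q\<close>
  says that \<open>d\<close> is a correctly built tree with conclusion \<open>[P] r [Q]\<close>.
\<close>

datatype 'v il_tree =
    T_assign "'v store set" 'v "'v aexp"
  | T_assume "'v store set" "'v bexp"
  | T_nondet "'v store set" 'v
  | T_skip "'v store set"
  | T_er_id "'v store set" "'v rcmd"
  | T_disj "'v il_tree" "'v il_tree"
  | T_cons "'v assn" "'v assn" "'v il_tree"
  | T_seq "'v il_tree" "'v il_tree"
  | T_choiceL "'v il_tree" "'v rcmd"
  | T_choiceR "'v rcmd" "'v il_tree"
  | T_iter0 "'v assn" "'v rcmd"
  | T_unroll "'v il_tree"

inductive il_proof :: "'v il_tree \<Rightarrow> 'v assn \<Rightarrow> 'v rcmd \<Rightarrow> 'v assn \<Rightarrow> bool" where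
  il_assign: "il_proof (T_assign P x a) (ok P) (Atom (Assign x a)) (ok (sp_assign x a P))"
| il_assume: "il_proof (T_assume P b) (ok P) (Atom (Assume b)) (ok (P \<inter> holds b))"
| il_nondet: "il_proof (T_nondet P x) (ok P) (Atom (Nondet x)) (ok (ex_var x P))"
| il_skip: "il_proof (T_skip P) (ok P) (Atom Skip) (ok P)"
| il_er_id: "il_proof (T_er_id P r) (er P) r (er P)"
| il_disj: "\<lbrakk>il_proof d1 P1 r Q1; il_proof d2 P2 r Q2\<rbrakk>
    \<Longrightarrow> il_proof (T_disj d1 d2) (P1 \<union> P2) r (Q1 \<union> Q2)"
| il_cons: "\<lbrakk>il_proof d P' r Q'; P' \<subseteq> P; Q \<subseteq> Q'\<rbrakk> \<Longrightarrow> il_proof (T_cons P Q d) P r Q"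
| il_seq: "\<lbrakk>il_proof d1 P r1 R; il_proof d2 R r2 Q\<rbrakk> \<Longrightarrow> il_proof (T_seq d1 d2) P (Seq r1 r2) Q"
| il_choiceL: "il_proof d P r1 Q \<Longrightarrow> il_proof (T_choiceL d r2) P (Choice r1 r2) Q"
| il_choiceR: "il_proof d P r2 Q \<Longrightarrow> il_proof (T_choiceR r1 d) P (Choice r1 r2) Q"
| il_iter0: "il_proof (T_iter0 P r) P (Star r) P"
| il_unroll: "il_proof d P (Seq (Star r) r) Q \<Longrightarrow> il_proof (T_unroll d) P (Star r) Q"

text \<open>
  The axiom trees are correctly built by definition; every other rule requires the tree in its
  conclusion to be a correctly built proof of a triple for the same command.
\<close>

inductive uturn :: "'v il_tree \<Rightarrow> 'v assn \<Rightarrow> 'v rcmd \<Rightarrow> 'v assn \<Rightarrow> bool" where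
  ut_assign: "Q' \<subseteq> sp_assign x a P
    \<Longrightarrow> uturn (T_assign P x a) (ok (P \<inter> subst Q' a x)) (Atom (Assign x a)) (ok Q')"
| ut_nondet: "Q' \<subseteq> ex_var x P
    \<Longrightarrow> uturn (T_nondet P x) (ok (P \<inter> ex_var x Q')) (Atom (Nondet x)) (ok Q')"
| ut_assume: "Q' \<subseteq> P \<inter> holds b \<Longrightarrow> uturn (T_assume P b) (ok Q') (Atom (Assume b)) (ok Q')"
| ut_skip: "Q' \<subseteq> ok P \<Longrightarrow> uturn (T_skip P) Q' (Atom Skip) Q'"
| ut_er_id: "Q' \<subseteq> P \<Longrightarrow> uturn (T_er_id P r) (er Q') r (er Q')"
| ut_empty: "il_proof d P r Q \<Longrightarrow> uturn d {} r {}"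
| ut_disj: "\<lbrakk>il_proof (T_disj d1 d2) P r Q; uturn d1 P1' r Q1'; uturn d2 P2' r Q2'\<rbrakk>
    \<Longrightarrow> uturn (T_disj d1 d2) (P1' \<union> P2') r (Q1' \<union> Q2')"
| ut_seq: "\<lbrakk>il_proof (T_seq d1 d2) P (Seq r1 r2) Q; uturn d1 P' r1 R'; uturn d2 R' r2 Q'\<rbrakk>
    \<Longrightarrow> uturn (T_seq d1 d2) P' (Seq r1 r2) Q'"
| ut_choiceL: "\<lbrakk>il_proof (T_choiceL d r2) P (Choice r1 r2) Q; uturn d P' r1 Q'\<rbrakk>
    \<Longrightarrow> uturn (T_choiceL d r2) P' (Choice r1 r2) Q'"
| ut_choiceR: "\<lbrakk>il_proof (T_choiceR r1 d) P (Choice r1 r2) Q; uturn d P' r2 Q'\<rbrakk>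
    \<Longrightarrow> uturn (T_choiceR r1 d) P' (Choice r1 r2) Q'"
| ut_iter0: "Q' \<subseteq> P \<Longrightarrow> uturn (T_iter0 P r) Q' (Star r) Q'"
| ut_unroll: "\<lbrakk>il_proof (T_unroll d) P (Star r) Q; uturn d P' (Seq (Star r) r) Q'\<rbrakk>
    \<Longrightarrow> uturn (T_unroll d) P' (Star r) Q'"
| ut_consIL: "\<lbrakk>il_proof (T_cons P Q d) P r Q; uturn d P'' r Q''; Q'' \<subseteq> Q\<rbrakk>
    \<Longrightarrow> uturn (T_cons P Q d) P'' r Q''"
| ut_consSIL: "\<lbrakk>il_proof d P r Q; uturn d P'' r Q''; P' \<noteq> {}; P' \<subseteq> P''; Q'' \<subseteq> Q'; Q' \<subseteq> Q\<rbrakk>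
    \<Longrightarrow> uturn d P' r Q'"

end

theory Submission imports Defs begin

text \<open>
  Induction on the U-Turn derivation. The postcondition bound in the consequence rule for SIL
  mentions some conclusion of the IL tree; it transfers to the given conclusion because a tree
  determines the pre- and postcondition it proves for a command.
\<close>

section \<open>Determinacy of IL proof trees\<close>

inductive_cases il_proof_treeE:
  "il_proof (T_assign P0 x a) P r Q"
  "il_proof (T_assume P0 b) P r Q"
  "il_proof (T_nondet P0 x) P r Q"
  "il_proof (T_skip P0) P r Q"
  "il_proof (T_er_id P0 r0) P r Q"
  "il_proof (T_disj d1 d2) P r Q"
  "il_proof (T_cons P0 Q0 d) P r Q"
  "il_proof (T_seq d1 d2) P r Q"
  "il_proof (T_choiceL d r2) P r Q"
  "il_proof (T_choiceR r1 d) P r Q"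
  "il_proof (T_iter0 P0 r0) P r Q"
  "il_proof (T_unroll d) P r Q"

text \<open>Axiom nodes store their precondition and \<open>T_cons\<close> stores both assertions;
  every other node inherits its assertions from its subtrees.\<close>

lemma il_proof_unique:
  assumes "il_proof d P r Q" and "il_proof d P1 r Q1"
  shows "P1 = P \<and> Q1 = Q"
  using assms
proof (induction arbitrary: P1 Q1 rule: il_proof.induct)
  case (il_disj d1 P1' r Q1' d2 P2' Q2')
  from il_disj.prems obtain P1'' Q1'' P2'' Q2''
    where "il_proof d1 P1'' r Q1''" "il_proof d2 P2'' r Q2''" "P1 = P1'' \<union> P2''" "Q1 = Q1'' \<union> Q2''"
    by (rule il_proof_treeE)
  with il_disj.IH show ?case by metis
next
  case (il_seq d1 P r1 R d2 r2 Q)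
  from il_seq.prems obtain R' where "il_proof d1 P1 r1 R'" "il_proof d2 R' r2 Q1"
    by (rule il_proof_treeE) simp
  \<comment> \<open>The first subtree forces \<open>R' = R\<close>; only then does the second
    induction hypothesis apply.\<close>
  with il_seq.IH show ?case by metis
next
  case (il_choiceL d P r1 Q r2)
  from il_choiceL.prems have "il_proof d P1 r1 Q1"
    by (rule il_proof_treeE) simp
  then show ?case by (rule il_choiceL.IH)
next
  case (il_choiceR d P r2 Q r1)
  from il_choiceR.prems have "il_proof d P1 r2 Q1"
    by (rule il_proof_treeE) simp
  then show ?case by (rule il_choiceR.IH)
next
  case (il_unroll d P r Q)
  from il_unroll.prems have "il_proof d P1 (Seq (Star r) r) Q1"
    by (rule il_proof_treeE) simp
  then show ?case by (rule il_unroll.IH)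
next
  case (il_cons d P' r Q' P Q)
  from il_cons.prems show ?case
    by (rule il_proof_treeE) simp
qed (erule il_proof_treeE, simp)+

section \<open>Semantic equations valid for ok-states and error states alike\<close>

lemma er_strict_simps [simp]:
  "er_strict f (Ok, \<sigma>) = f \<sigma>"
  "er_strict f (Er, \<sigma>) = {(Er, \<sigma>)}"
  by (simp_all add: er_strict_def)

lemma sem_Er [simp]: "sem r (Er, \<sigma>) = {(Er, \<sigma>)}"
  by (cases r) simp_all

lemma sem_Seq: "sem (Seq r1 r2) st = lift (sem r2) (sem r1 st)"
proof (cases st)
  case (Pair f \<sigma>)
  then show ?thesis by (cases f) (simp_all add: lift_def)
qed

lemma sem_ChoiceL: "sem r1 st \<subseteq> sem (Choice r1 r2) st"
  and sem_ChoiceR: "sem r2 st \<subseteq> sem (Choice r1 r2) st"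
proof -
  obtain f \<sigma> where "st = (f, \<sigma>)" by (cases st)
  then show "sem r1 st \<subseteq> sem (Choice r1 r2) st" "sem r2 st \<subseteq> sem (Choice r1 r2) st"
    by (cases f; simp)+
qed

lemma funpow_lift_sem_Er: "(lift (sem r) ^^ n) {(Er, \<sigma>)} = {(Er, \<sigma>)}"
  by (induction n) (simp_all add: lift_def)

lemma sem_Star: "sem (Star r) st = (\<Union>n. (lift (sem r) ^^ n) {st})"
proof (cases st)
  case (Pair f \<sigma>)
  then show ?thesis
    by (cases f) (simp_all add: funpow_lift_sem_Er)
qed

lemma sem_Star_refl: "st \<in> sem (Star r) st"
  unfolding sem_Star by (rule UN_I[of 0]) simp_all

text \<open>One run of \<open>r\<close> after \<open>n\<close> iterations makes \<open>Suc n\<close>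
  iterations; \<open>^^\<close> puts the extra application outermost, that is, last in time.\<close>

lemma sem_Star_unroll: "sem (Seq (Star r) r) st \<subseteq> sem (Star r) st"
proof
  fix t assume "t \<in> sem (Seq (Star r) r) st"
  then obtain n where "t \<in> (lift (sem r) ^^ Suc n) {st}"
    unfolding sem_Seq sem_Star lift_def[of _ "\<Union>_"] by (auto simp: lift_def)
  then show "t \<in> sem (Star r) st"
    unfolding sem_Star by blast
qed

section \<open>Validity of SIL triples, state by state\<close>

lemma valid_SIL_iff: "valid_SIL P r Q \<longleftrightarrow> (\<forall>st\<in>P. \<exists>t\<in>Q. t \<in> sem r st)"
  by (auto simp: valid_SIL_def lift_def back_sem_def)

text \<open>Reaching \<open>Q\<close> is existential, so extra behaviours do no harm. Passing to a
  larger command covers the choice and unroll rules, while the other two inclusions cover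
  consequence.\<close>

lemma valid_SIL_mono:
  assumes "valid_SIL P r Q" "P1 \<subseteq> P" "Q \<subseteq> Q1" "\<And>st. sem r st \<subseteq> sem r1 st"
  shows "valid_SIL P1 r1 Q1"
  using assms unfolding valid_SIL_iff by blast

lemma valid_SIL_Un:
  assumes "valid_SIL P1 r Q1" "valid_SIL P2 r Q2"
  shows "valid_SIL (P1 \<union> P2) r (Q1 \<union> Q2)"
  using assms unfolding valid_SIL_iff by blast

lemma valid_SIL_Seq:
  assumes "valid_SIL P r1 R" "valid_SIL R r2 Q"
  shows "valid_SIL P (Seq r1 r2) Q"
  using assms unfolding valid_SIL_iff sem_Seq lift_def by blast

lemma valid_SIL_refl:
  assumes "\<And>st. st \<in> P \<Longrightarrow> st \<in> sem r st"
  shows "valid_SIL P r P"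
  using assms unfolding valid_SIL_iff by blast

section \<open>Tagged assertions and the rules for assignment and nondeterminism\<close>

lemma ok_subset_iff [simp]: "ok P \<subseteq> ok Q \<longleftrightarrow> P \<subseteq> Q"
  by (auto simp: ok_def)

lemma er_subset_iff [simp]: "er P \<subseteq> er Q \<longleftrightarrow> P \<subseteq> Q"
  by (auto simp: er_def)

lemma ok_eq_empty_iff [simp]: "ok P = {} \<longleftrightarrow> P = {}"
  by (auto simp: ok_def)

lemma er_eq_empty_iff [simp]: "er P = {} \<longleftrightarrow> P = {}"
  by (auto simp: er_def)

text \<open>Supplies the emptiness clause for assignment: a store of \<open>Q\<close> has a preimage
  in \<open>P\<close>, and that preimage lies in \<open>subst Q a x\<close>.\<close>

lemma subst_sp_assign_eq_empty_iff:
  assumes "Q \<subseteq> sp_assign x a P"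
  shows "P \<inter> subst Q a x = {} \<longleftrightarrow> Q = {}"
proof
  assume empty: "P \<inter> subst Q a x = {}"
  have "\<tau> \<notin> Q" for \<tau>
  proof
    assume "\<tau> \<in> Q"
    with assms have "\<tau> \<in> sp_assign x a P" by (rule subsetD)
    then obtain \<sigma> where "\<tau> = \<sigma>(x := aval a \<sigma>)" "\<sigma> \<in> P"
      unfolding sp_assign_def by (elim CollectE exE conjE)
    with \<open>\<tau> \<in> Q\<close> have "\<sigma> \<in> P \<inter> subst Q a x" by (simp add: subst_def)
    with empty show False by simp
  qed
  then show "Q = {}" by auto
qed (simp add: subst_def)

text \<open>Writing the old value \<open>\<sigma> x\<close> back into the updated store restores
  \<open>\<sigma>\<close>.\<close>

lemma ex_var_upd: "\<sigma>(x := v) \<in> Q \<Longrightarrow> \<sigma> \<in> ex_var x Q"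
  unfolding ex_var_def by (rule CollectI, rule exI[of _ "\<sigma>(x := v)"], rule exI[of _ "\<sigma> x"]) simp

lemma ex_var_eq_empty_iff:
  assumes "Q \<subseteq> ex_var x P"
  shows "P \<inter> ex_var x Q = {} \<longleftrightarrow> Q = {}"
proof
  assume empty: "P \<inter> ex_var x Q = {}"
  have "\<tau> \<notin> Q" for \<tau>
  proof
    assume "\<tau> \<in> Q"
    with assms have "\<tau> \<in> ex_var x P" by (rule subsetD)
    then obtain \<sigma> v where "\<tau> = \<sigma>(x := v)" "\<sigma> \<in> P"
      unfolding ex_var_def by (elim CollectE exE conjE)
    with \<open>\<tau> \<in> Q\<close> have "\<sigma> \<in> P \<inter> ex_var x Q" by (simp add: ex_var_upd)
    with empty show False by simp
  qed
  then show "Q = {}" by auto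
qed (simp add: ex_var_def)

lemma valid_SIL_Assign: "valid_SIL (ok (subst Q a x)) (Atom (Assign x a)) (ok Q)"
  by (auto simp: valid_SIL_iff ok_def subst_def)

lemma valid_SIL_Nondet: "valid_SIL (ok (ex_var x Q)) (Atom (Nondet x)) (ok Q)"
proof -
  have "\<exists>v. \<sigma>(x := v) \<in> Q" if "\<sigma> \<in> ex_var x Q" for \<sigma>
  proof -
    from that obtain \<tau> v where "\<tau> \<in> Q" "\<sigma> = \<tau>(x := v)"
      by (auto simp: ex_var_def)
    \<comment> \<open>Choosing the value \<open>\<tau> x\<close> overwrites \<open>v\<close> and
      gives back \<open>\<tau>\<close>.\<close>
    then have "\<sigma>(x := \<tau> x) \<in> Q" by simp
    then show ?thesis ..
  qed
  then show ?thesis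
    by (auto simp: valid_SIL_iff ok_def image_iff)
qed

section \<open>Soundness of the U-Turn rules\<close>

theorem theorem4p2:
  fixes d :: "('v::finite) il_tree"
    and r :: "'v rcmd"
    and P Q P' Q' :: "'v assn"
  assumes "il_proof d P r Q"
    and "uturn d P' r Q'"
  shows "valid_SIL P' r Q' \<and> P' \<subseteq> P \<and> Q' \<subseteq> Q
    \<and> ((P' = {} \<and> Q' = {}) \<or> (P' \<noteq> {} \<and> Q' \<noteq> {}))"
  \<comment> \<open>The U-Turn derivation comes first so that the induction runs on it;
    \<open>P\<close> and \<open>Q\<close> must vary because subtrees have other conclusions.\<close>
  using assms(2,1)
proof (induction arbitrary: P Q rule: uturn.induct)
  case (ut_assign Q' x a P0)
  have "P = ok P0" "Q = ok (sp_assign x a P0)"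
    using il_proof_unique[OF il_assign ut_assign.prems] by simp_all
  moreover have "valid_SIL (ok (P0 \<inter> subst Q' a x)) (Atom (Assign x a)) (ok Q')"
    \<comment> \<open>Intersecting with \<open>P0\<close> only shrinks the precondition; it is what
      yields the inclusion in \<open>P\<close>.\<close>
    by (rule valid_SIL_mono[OF valid_SIL_Assign _ order_refl order_refl]) simp
  ultimately show ?case
    using ut_assign.hyps subst_sp_assign_eq_empty_iff[OF ut_assign.hyps] by auto
next
  case (ut_nondet Q' x P0)
  have "P = ok P0" "Q = ok (ex_var x P0)"
    using il_proof_unique[OF il_nondet ut_nondet.prems] by simp_all
  moreover have "valid_SIL (ok (P0 \<inter> ex_var x Q')) (Atom (Nondet x)) (ok Q')"
    by (rule valid_SIL_mono[OF valid_SIL_Nondet _ order_refl order_refl]) simp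
  ultimately show ?case
    using ut_nondet.hyps ex_var_eq_empty_iff[OF ut_nondet.hyps] by auto
next
  case (ut_assume Q' P0 b)
  have "P = ok P0" "Q = ok (P0 \<inter> holds b)"
    using il_proof_unique[OF il_assume ut_assume.prems] by simp_all
  moreover have "valid_SIL (ok Q') (Atom (Assume b)) (ok Q')"
    using ut_assume.hyps by (intro valid_SIL_refl) (auto simp: ok_def holds_def)
  ultimately show ?case
    using ut_assume.hyps by auto
next
  case (ut_skip Q' P0)
  have "P = ok P0" "Q = ok P0"
    using il_proof_unique[OF il_skip ut_skip.prems] by simp_all
  moreover have "valid_SIL Q' (Atom Skip) Q'"
    using ut_skip.hyps by (intro valid_SIL_refl) (auto simp: ok_def)
  ultimately show ?case
    using ut_skip.hyps by auto
next
  case (ut_er_id Q' P0 r)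
  have "P = er P0" "Q = er P0"
    using il_proof_unique[OF il_er_id ut_er_id.prems] by simp_all
  moreover have "valid_SIL (er Q') r (er Q')"
    by (intro valid_SIL_refl) (auto simp: er_def)
  ultimately show ?case
    using ut_er_id.hyps by auto
next
  case ut_empty
  then show ?case by (simp add: valid_SIL_iff)
next
  case (ut_disj d1 d2 P0 r Q0 P1' Q1' P2' Q2')
  \<comment> \<open>Inverting the given IL proof, not the one stored in the rule, makes the bounds
    refer to \<open>P\<close> and \<open>Q\<close>.\<close>
  from ut_disj.prems obtain P1 Q1 P2 Q2
    where "il_proof d1 P1 r Q1" "il_proof d2 P2 r Q2" "P = P1 \<union> P2" "Q = Q1 \<union> Q2"
    by (rule il_proof_treeE)
  with ut_disj.IH(1)[of P1 Q1] ut_disj.IH(2)[of P2 Q2] show ?case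
    using valid_SIL_Un[of P1' r Q1' P2' Q2'] by blast
next
  case (ut_seq d1 d2 P0 r1 r2 Q0 P' R' Q')
  from ut_seq.prems obtain R where "il_proof d1 P r1 R" "il_proof d2 R r2 Q"
    by (rule il_proof_treeE) simp
  \<comment> \<open>Emptiness is transferred between \<open>P'\<close> and \<open>Q'\<close> through
    \<open>R'\<close>.\<close>
  then show ?case
    using ut_seq.IH(1)[of P R] ut_seq.IH(2)[of R Q] valid_SIL_Seq[of P' r1 R' r2 Q'] by auto
next
  case (ut_choiceL d r2 P0 r1 Q0 P' Q')
  from ut_choiceL.prems have "il_proof d P r1 Q"
    by (rule il_proof_treeE) simp
  from ut_choiceL.IH[OF this] show ?case
    using valid_SIL_mono[of P' r1 Q', OF _ order_refl order_refl sem_ChoiceL] by auto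
next
  case (ut_choiceR r1 d P0 r2 Q0 P' Q')
  from ut_choiceR.prems have "il_proof d P r2 Q"
    by (rule il_proof_treeE) simp
  from ut_choiceR.IH[OF this] show ?case
    using valid_SIL_mono[of P' r2 Q', OF _ order_refl order_refl sem_ChoiceR] by auto
next
  case (ut_iter0 Q' P0 r)
  have "P = P0" "Q = P0"
    using il_proof_unique[OF il_iter0 ut_iter0.prems] by simp_all
  with ut_iter0.hyps show ?case
    using valid_SIL_refl[of Q' "Star r", OF sem_Star_refl] by auto
next
  case (ut_unroll d P0 r Q0 P' Q')
  from ut_unroll.prems have "il_proof d P (Seq (Star r) r) Q"
    by (rule il_proof_treeE) simp
  from ut_unroll.IH[OF this] show ?case
    using valid_SIL_mono[of P' "Seq (Star r) r" Q', OF _ order_refl order_refl sem_Star_unroll]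
    by auto
next
  case (ut_consIL P0 Q0 d r P'' Q'')
  from ut_consIL.prems obtain P1 Q1 where "il_proof d P1 r Q1" "P1 \<subseteq> P" "Q = Q0"
    by (rule il_proof_treeE) simp
  with ut_consIL.IH[of P1 Q1] ut_consIL.hyps show ?case
    by blast
next
  case (ut_consSIL d P0 r Q0 P'' Q'' P' Q')
  have "Q = Q0"
    using il_proof_unique[OF ut_consSIL.hyps(1) ut_consSIL.prems] by simp
  moreover have "valid_SIL P' r Q'"
    using ut_consSIL.IH[OF ut_consSIL.prems] ut_consSIL.hyps valid_SIL_mono[of P'' r Q'' P' Q', OF _ _ _ order_refl]
    by auto
  \<comment> \<open>Nonemptiness travels from \<open>P'\<close> up to \<open>P''\<close>, by
    induction to \<open>Q''\<close>, and from there up to \<open>Q'\<close>.\<close>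
  ultimately show ?case
    using ut_consSIL.IH[OF ut_consSIL.prems] ut_consSIL.hyps by blast
qed

end
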